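(* Let $f:\mathbb{R}^d\to\mathbb{R}^d$ be a homeomorphism such that $f^{-1}$ is $L$-Lipschitz, let $Q\subset\mathbb{R}^d$ be a box, and let $M\ge1$ be an integer. Let $\Omega_n=\{D_i^n:i\in I_n\}$, $n\in\mathbb{N}$, be the dyadic box covers of $Q$ and let $z^{i,n}_0,\ldots,z^{i,n}_{M^d-1}$ and $\varrho_n$ be the subbox centers and diameters described in the context. Define $\varphi_n:I_n\to2^{I_n}$ by $$\varphi_n(i):=\Big\{j\in I_n:\ \Big(\bigcup_{l=0}^{M^d-1}\{f^{-1}(z^{i,n}_{l})\}+B_{L\varrho_n}(0)\Big)\cap D_j^n\neq\emptyset\Big\}.$$ Then $$\lim_{n\to\infty}\sup_{i\in I_n}\operatorname{dist}\Big(\bigcup_{j\in\varphi_n(i)}D_j^n,\ f^{-1}(D_i^n)\Big)=0$$ and $$\big(f^{-1}(D_i^n)\cap Q\big)\subset\bigcup_{j\in\varphi_n(i)}D_j^n\quad\text{for all } i\in I_n,\ n\in\mathbb{N}.$$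
   Context: $\mathbb{N}=\{0,1,2,\ldots\}$, $\|\cdot\|$ is a fixed vector norm on $\mathbb{R}^d$, and $B_r(0)=\{x:\|x\|\le r\}$. For $X,Y\subset\mathbb{R}^d$, $\operatorname{diam}(X)=\sup_{x\in X}\sup_{y\in X}\|x-y\|$ and $\operatorname{dist}(X,Y)=\sup_{x\in X}\inf_{y\in Y}\|x-y\|$ (one-sided semidistance, $\sup\emptyset=0$); sums of sets are Minkowski sums. A box is a product of $d$ compact nondegenerate intervals. Construction of the covers: $\rho_0:=\operatorname{diam}(Q)$, $I_0=\{0\}$, $D_0^0=Q$. Given the boxes $D_i^n$, $i\in I_n=\{0,\ldots,2^{nd}-1\}$, each $D_i^n$ is subdivided into $2^d$ congruent subboxes (halving each edge) $D^{n+1}_{i2^d},\ldots,D^{n+1}_{(i+1)2^d-1}$; set $I_{n+1}:=\{0,\ldots,2^{(n+1)d}-1\}$ and $\rho_{n+1}:=\frac12\rho_n$. Further, each $D_i^n$ is decomposed into $M^d$ congruent subboxes $E^{i,n}_0,\ldots,E^{i,n}_{M^d-1}$ (dividing each edge into $M$ equal parts) with centers $z^{i,n}_0,\ldots,z^{i,n}_{M^d-1}$ and diameter $\varrho_n:=\rho_n/M$. *)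

theory Defs
  imports "HOL-Analysis.Analysis" "HOL-Library.Set_Algebras"
begin

(* Type-class norms and distances are Euclidean on real ^ 'n; since the norm is
   arbitrary here, it is an explicit function N and the metric notions are relative to N. *)

definition vector_norm :: "(real ^ 'n \<Rightarrow> real) \<Rightarrow> bool" where
  "vector_norm N \<longleftrightarrow>
     (\<forall>x. 0 \<le> N x) \<and> (\<forall>x. N x = 0 \<longleftrightarrow> x = 0) \<and>
     (\<forall>c x. N (c *\<^sub>R x) = \<bar>c\<bar> * N x) \<and> (\<forall>x y. N (x + y) \<le> N x + N y)"

definition nball :: "(real ^ 'n \<Rightarrow> real) \<Rightarrow> real \<Rightarrow> (real ^ 'n) set" where
  "nball N r = {x. N x \<le> r}"

definition lipschitz_wrt ::
    "(real ^ 'n \<Rightarrow> real) \<Rightarrow> real \<Rightarrow> (real ^ 'n \<Rightarrow> real ^ 'n) \<Rightarrow> bool" where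
  "lipschitz_wrt N L g \<longleftrightarrow> 0 \<le> L \<and> (\<forall>x y. N (g x - g y) \<le> L * N (x - y))"

(* Values in [0, \<infinity>], where the supremum of the empty set is 0
   and the infimum of the empty set is \<infinity>. *)

definition diam :: "(real ^ 'n \<Rightarrow> real) \<Rightarrow> (real ^ 'n) set \<Rightarrow> ennreal" where
  "diam N X = (SUP x\<in>X. SUP y\<in>X. ennreal (N (x - y)))"

definition semidist ::
    "(real ^ 'n \<Rightarrow> real) \<Rightarrow> (real ^ 'n) set \<Rightarrow> (real ^ 'n) set \<Rightarrow> ennreal" where
  "semidist N X Y = (SUP x\<in>X. INF y\<in>Y. ennreal (N (x - y)))"

definition is_box :: "(real ^ 'n) set \<Rightarrow> bool" where
  "is_box B \<longleftrightarrow> (\<exists>a b. (\<forall>j. a $ j < b $ j) \<and> B = cbox a b)"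

definition box_center :: "(real ^ 'n) set \<Rightarrow> real ^ 'n" where
  "box_center B = midpoint (interval_lowerbound B) (interval_upperbound B)"

(* The m ^ CARD('n) congruent subboxes of the box B that arise from dividing every edge
   into m equal parts; k j is the position of the chosen part on the j-th edge. *)

definition subboxes :: "nat \<Rightarrow> (real ^ 'n) set \<Rightarrow> (real ^ 'n) set set" where
  "subboxes m B =
     (let a = interval_lowerbound B; b = interval_upperbound B in
      {cbox (\<chi> j. a $ j + real (k j) * (b $ j - a $ j) / real m)
            (\<chi> j. a $ j + real (k j + 1) * (b $ j - a $ j) / real m)
       | k. \<forall>j. k j < m})"

definition idx :: "nat \<Rightarrow> nat \<Rightarrow> nat set" where
  "idx d n = {0..<2 ^ (n * d)}"

(* The order in which the subboxes of one box are numbered is left open in the next two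
   definitions: D and E may be any families numbered consistently with the subdivision. *)

definition dyadic_boxes ::
    "(real ^ 'n) set \<Rightarrow> (nat \<Rightarrow> nat \<Rightarrow> (real ^ 'n) set) \<Rightarrow> bool" where
  "dyadic_boxes Q D \<longleftrightarrow>
     D 0 0 = Q \<and>
     (\<forall>n. \<forall>i\<in>idx CARD('n) n.
        bij_betw (\<lambda>k. D (Suc n) (i * 2 ^ CARD('n) + k)) {0..<2 ^ CARD('n)} (subboxes 2 (D n i)))"

definition fine_boxes ::
    "nat \<Rightarrow> (nat \<Rightarrow> nat \<Rightarrow> (real ^ 'n) set) \<Rightarrow>
     (nat \<Rightarrow> nat \<Rightarrow> nat \<Rightarrow> (real ^ 'n) set) \<Rightarrow> bool" where
  "fine_boxes M D E \<longleftrightarrow>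
     (\<forall>n. \<forall>i\<in>idx CARD('n) n.
        bij_betw (\<lambda>l. E n i l) {0..<M ^ CARD('n)} (subboxes M (D n i)))"

primrec rho :: "(real ^ 'n \<Rightarrow> real) \<Rightarrow> (real ^ 'n) set \<Rightarrow> nat \<Rightarrow> real" where
  "rho N Q 0 = enn2real (diam N Q)"
| "rho N Q (Suc n) = 1 / 2 * rho N Q n"

definition varrho :: "(real ^ 'n \<Rightarrow> real) \<Rightarrow> (real ^ 'n) set \<Rightarrow> nat \<Rightarrow> nat \<Rightarrow> real" where
  "varrho N Q M n = rho N Q n / real M"

definition phi ::
    "(real ^ 'n \<Rightarrow> real) \<Rightarrow> (real ^ 'n \<Rightarrow> real ^ 'n) \<Rightarrow> real \<Rightarrow> (real ^ 'n) set \<Rightarrow> nat \<Rightarrow>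
     (nat \<Rightarrow> nat \<Rightarrow> (real ^ 'n) set) \<Rightarrow> (nat \<Rightarrow> nat \<Rightarrow> nat \<Rightarrow> (real ^ 'n) set) \<Rightarrow>
     nat \<Rightarrow> nat \<Rightarrow> nat set" where
  "phi N f L Q M D E n i =
     {j \<in> idx CARD('n) n.
        ((\<Union>l\<in>{0..<M ^ CARD('n)}. {inv f (box_center (E n i l))})
          + nball N (L * varrho N Q M n)) \<inter> D n j \<noteq> {}}"

end

theory Submission
  imports Defs
begin

text \<open>
  All boxes of level \<open>n\<close> are translates of \<open>Q\<close> scaled by \<open>2\<^sup>-\<^sup>n\<close>, so
  their diameter is \<open>\<rho>\<^sub>n\<close>, and the subboxes have diameter \<open>\<rho>\<^sub>n / M\<close>. A point of \<open>D\<^sub>j\<close> with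
  \<open>j \<in> \<phi>\<^sub>n(i)\<close> is therefore within \<open>\<rho>\<^sub>n + L \<rho>\<^sub>n / M\<close> of the preimage of some subbox center
  of \<open>D\<^sub>i\<close>, a bound that tends to \<open>0\<close>. Conversely, a point of \<open>f\<^sup>-\<^sup>1(D\<^sub>i) \<inter> Q\<close> lies in some \<open>D\<^sub>j\<close>
  and, by the Lipschitz condition, within \<open>L \<rho>\<^sub>n / M\<close> of the preimage of a center,
  whence \<open>j \<in> \<phi>\<^sub>n(i)\<close>.
\<close>

section \<open>Boundedness and scaling of boxes in an arbitrary norm\<close>

text \<open>Expand \<open>x\<close> in the standard basis and apply subadditivity and homogeneity.
  This turns coordinate bounds on a box into bounds for \<open>N\<close>.\<close>

lemma vector_norm_le_sum:
  fixes N :: "real ^ 'n \<Rightarrow> real"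
  assumes "vector_norm N"
  shows "N x \<le> (\<Sum>j\<in>UNIV. \<bar>x $ j\<bar> * N (axis j 1))"
proof -
  have hom: "N (c *\<^sub>R x) = \<bar>c\<bar> * N x" and tri: "N (x + y) \<le> N x + N y" for c x y
    using assms by (auto simp: vector_norm_def)
  have zero: "N 0 = 0" using assms by (auto simp: vector_norm_def)
  have "N (\<Sum>j\<in>A. g j) \<le> (\<Sum>j\<in>A. N (g j))" if "finite A" for A and g :: "'n \<Rightarrow> real ^ 'n"
    using that
  proof induction
    case (insert j A)
    then show ?case using tri[of "g j" "sum g A"] by simp
  qed (simp add: zero)
  from this[of UNIV "\<lambda>j. x $ j *\<^sub>R axis j 1"]
  have "N (\<Sum>j\<in>UNIV. x $ j *\<^sub>R axis j 1) \<le> (\<Sum>j\<in>UNIV. \<bar>x $ j\<bar> * N (axis j 1))"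
    by (simp add: hom)
  also have "(\<Sum>j\<in>UNIV. x $ j *\<^sub>R axis j 1) = x"
    by (metis basis_expansion scalar_mult_eq_scaleR)
  finally show ?thesis .
qed

text \<open>Coordinates of two points of a box differ by at most the edge lengths, which bounds
  \<open>N\<close> uniformly. Finiteness matters because \<open>rho\<close> passes through
  \<open>enn2real\<close>, which sends infinity to 0.\<close>

lemma diam_cbox_finite:
  fixes N :: "real ^ 'n \<Rightarrow> real"
  assumes "vector_norm N"
  shows "diam N (cbox a b) < \<infinity>"
proof -
  let ?K = "\<Sum>j\<in>UNIV. \<bar>b $ j - a $ j\<bar> * N (axis j 1)"
  have nonneg: "0 \<le> N x" for x using assms by (simp add: vector_norm_def)
  have "N (x - y) \<le> ?K" if "x \<in> cbox a b" "y \<in> cbox a b" for x y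
  proof -
    have "\<bar>(x - y) $ j\<bar> \<le> \<bar>b $ j - a $ j\<bar>" for j
    proof -
      have "a $ j \<le> x $ j" "x $ j \<le> b $ j" "a $ j \<le> y $ j" "y $ j \<le> b $ j"
        using that by (auto simp: mem_box_cart)
      then show ?thesis by simp
    qed
    then have "(\<Sum>j\<in>UNIV. \<bar>(x - y) $ j\<bar> * N (axis j 1)) \<le> ?K"
      by (intro sum_mono mult_right_mono nonneg)
    with vector_norm_le_sum[OF assms, of "x - y"] show ?thesis by linarith
  qed
  then have "diam N (cbox a b) \<le> ennreal ?K"
    unfolding diam_def by (intro SUP_least ennreal_leI)
  then show ?thesis by (simp add: le_less_trans)
qed

text \<open>Scaling the difference of two points of the smaller box by \<open>1 / c\<close> gives a difference of two
  points of the larger box.\<close>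

lemma norm_diff_le_scaled_diam:
  fixes N :: "real ^ 'n \<Rightarrow> real"
  assumes N: "vector_norm N" and c: "0 < c"
    and x: "x \<in> cbox p (p + c *\<^sub>R w)" and y: "y \<in> cbox p (p + c *\<^sub>R w)"
  shows "N (x - y) \<le> c * enn2real (diam N (cbox q (q + w)))"
proof -
  let ?Q = "cbox q (q + w)"
  have nonneg: "0 \<le> N x" for x using N by (simp add: vector_norm_def)
  define T where "T v = q + (1 / c) *\<^sub>R (v - p)" for v
  have T: "T v \<in> ?Q" if "v \<in> cbox p (p + c *\<^sub>R w)" for v
  proof -
    have "0 \<le> (v $ j - p $ j) / c" "(v $ j - p $ j) / c \<le> w $ j" for j
    proof -
      have "p $ j \<le> v $ j" "v $ j \<le> p $ j + c * w $ j"
        using that by (auto simp: mem_box_cart)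
      then show "0 \<le> (v $ j - p $ j) / c" "(v $ j - p $ j) / c \<le> w $ j"
        using c by (auto simp: pos_divide_le_eq mult.commute)
    qed
    then show ?thesis by (simp add: T_def mem_box_cart)
  qed
  have "ennreal (N (T x - T y)) \<le> diam N ?Q"
    unfolding diam_def by (intro SUP_upper2[OF T[OF x]] SUP_upper2[OF T[OF y]] order_refl)
  \<comment> \<open>\<open>enn2real\<close> is monotone only below a finite upper bound, hence the
    appeal to \<open>diam_cbox_finite\<close>.\<close>
  then have "enn2real (ennreal (N (T x - T y))) \<le> enn2real (diam N ?Q)"
    using diam_cbox_finite[OF N, of q "q + w"] by (intro enn2real_mono) auto
  then have "N (T x - T y) \<le> enn2real (diam N ?Q)"
    by (simp add: nonneg)
  moreover have "x - y = c *\<^sub>R (T x - T y)"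
    using c by (simp add: T_def algebra_simps)
  then have "N (x - y) = c * N (T x - T y)"
    using N c by (simp add: vector_norm_def)
  ultimately show ?thesis using c by simp
qed

section \<open>Centers and subdivisions of a box\<close>

lemma box_center_mem:
  fixes p w :: "real ^ 'n"
  assumes "\<And>j. 0 \<le> w $ j"
  shows "box_center (cbox p (p + w)) \<in> cbox p (p + w)"
proof -
  have "cbox p (p + w) \<noteq> {}"
    using assms by (simp add: interval_ne_empty_cart)
  then have "box_center (cbox p (p + w)) = midpoint p (p + w)"
    by (simp add: box_center_def)
  then show ?thesis
    using assms by (auto simp: midpoint_def mem_box_cart field_simps)
qed

text \<open>Writing the upper corner as lower corner plus \<open>w / m\<close> shows that all
  subboxes are translates of one box. Nonnegative edges make the box nonempty, so its interval
  bounds really are \<open>p\<close> and \<open>p + w\<close>.\<close>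

lemma subboxes_translate:
  fixes p w :: "real ^ 'n"
  assumes "\<And>j. 0 \<le> w $ j"
  shows "subboxes m (cbox p (p + w)) =
    {cbox (\<chi> j. p $ j + real (k j) * w $ j / real m)
          ((\<chi> j. p $ j + real (k j) * w $ j / real m) + (1 / real m) *\<^sub>R w) | k. \<forall>j. k j < m}"
proof -
  have "cbox p (p + w) \<noteq> {}"
    using assms by (simp add: interval_ne_empty_cart)
  moreover have "(\<chi> j. p $ j + real (k j + 1) * w $ j / real m)
      = (\<chi> j. p $ j + real (k j) * w $ j / real m) + (1 / real m) *\<^sub>R w" for k
    by (simp add: vec_eq_iff add_divide_distrib distrib_right)
  ultimately show ?thesis by (simp add: subboxes_def)
qed

lemma mem_subboxes:
  fixes p w :: "real ^ 'n"
  assumes "\<And>j. 0 \<le> w $ j" and "B \<in> subboxes m (cbox p (p + w))"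
  shows "\<exists>q. B = cbox q (q + (1 / real m) *\<^sub>R w)"
  using assms by (auto simp: subboxes_translate)

lemma exists_part_of_unit_interval:
  fixes t :: real
  assumes "0 \<le> t" "t \<le> 1" "1 \<le> m"
  shows "\<exists>k<m. real k \<le> t * real m \<and> t * real m \<le> real k + 1"
proof (cases "t = 1")
  case True
  \<comment> \<open>At the right endpoint the floor would be \<open>m\<close>, one past the last
    part, so the index \<open>m - 1\<close> is taken instead.\<close>
  then show ?thesis using assms by (intro exI[of _ "m - 1"]) (auto simp: of_nat_diff)
next
  case False
  let ?k = "nat \<lfloor>t * real m\<rfloor>"
  have "t * real m < real m" using False assms by simp
  moreover have "0 \<le> t * real m" using assms by simp
  ultimately have "?k < m" "real ?k \<le> t * real m" "t * real m \<le> real ?k + 1"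
    by linarith+
  then show ?thesis by blast
qed

lemma Union_subboxes:
  fixes p w :: "real ^ 'n"
  assumes w: "\<And>j. 0 < w $ j" and m: "1 \<le> m"
  shows "\<Union> (subboxes m (cbox p (p + w))) = cbox p (p + w)"
proof (intro equalityI subsetI)
  have w': "\<And>j. 0 \<le> w $ j" using w less_imp_le by blast
  fix x assume x: "x \<in> cbox p (p + w)"
  \<comment> \<open>Each coordinate is rescaled to the unit interval, which needs positive edges;
    the part containing it is then chosen separately for every \<open>j\<close>.\<close>
  have "\<exists>k<m. real k \<le> (x $ j - p $ j) / w $ j * real m \<and>
      (x $ j - p $ j) / w $ j * real m \<le> real k + 1" for j
    using x w[of j] m by (intro exists_part_of_unit_interval) (auto simp: mem_box_cart field_simps)
  then obtain k where k: "\<And>j. k j < m"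
    "\<And>j. real (k j) \<le> (x $ j - p $ j) / w $ j * real m"
    "\<And>j. (x $ j - p $ j) / w $ j * real m \<le> real (k j) + 1"
    by metis
  have "x \<in> cbox (\<chi> j. p $ j + real (k j) * w $ j / real m)
      ((\<chi> j. p $ j + real (k j) * w $ j / real m) + (1 / real m) *\<^sub>R w)"
    unfolding mem_box_cart
  proof
    fix j
    show "(\<chi> j. p $ j + real (k j) * w $ j / real m) $ j \<le> x $ j \<and>
       x $ j \<le> ((\<chi> j. p $ j + real (k j) * w $ j / real m) + (1 / real m) *\<^sub>R w) $ j"
      using k(2,3)[of j] w[of j] m by (simp add: field_simps)
  qed
  then show "x \<in> \<Union> (subboxes m (cbox p (p + w)))"
    unfolding subboxes_translate[OF w'] using k(1) by blast
next
  have w': "\<And>j. 0 \<le> w $ j" using w less_imp_le by blast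
  fix x assume "x \<in> \<Union> (subboxes m (cbox p (p + w)))"
  then obtain k where k: "\<And>j. k j < m" and
    x: "x \<in> cbox (\<chi> j. p $ j + real (k j) * w $ j / real m)
      ((\<chi> j. p $ j + real (k j) * w $ j / real m) + (1 / real m) *\<^sub>R w)"
    unfolding subboxes_translate[OF w'] by blast
  show "x \<in> cbox p (p + w)"
    unfolding mem_box_cart
  proof
    fix j
    have lo: "p $ j + real (k j) * w $ j / real m \<le> x $ j"
      and up: "x $ j \<le> p $ j + real (k j) * w $ j / real m + w $ j / real m"
      using x by (auto simp: mem_box_cart)
    \<comment> \<open>The upper end of the part stays inside the edge because \<open>k j < m\<close>
      gives \<open>k j + 1 \<le> m\<close>.\<close>
    have "real (k j) * w $ j / real m + w $ j / real m = (real (k j) + 1) / real m * w $ j"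
      by (simp add: add_divide_distrib distrib_right)
    also have "\<dots> \<le> 1 * w $ j"
      using k[of j] w'[of j] by (intro mult_right_mono) auto
    finally have "x $ j \<le> p $ j + w $ j" using up by linarith
    moreover have "0 \<le> real (k j) * w $ j / real m" using w' by simp
    ultimately show "p $ j \<le> x $ j \<and> x $ j \<le> (p + w) $ j" using lo by simp
  qed
qed

section \<open>Shape and covering property of the dyadic boxes\<close>

text \<open>Each subdivision halves the edge vector; only the corner \<open>q\<close> depends on how
  the subboxes are numbered, so it is left existential.\<close>

lemma dyadic_boxes_shape:
  fixes Q :: "(real ^ 'n) set" and w :: "real ^ 'n"
  assumes D: "dyadic_boxes Q D" and Q: "Q = cbox p (p + w)" and w: "\<And>j. 0 < w $ j"
    and i: "i \<in> idx CARD('n) n"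
  shows "\<exists>q. D n i = cbox q (q + (1 / 2 ^ n) *\<^sub>R w)"
  using i
proof (induction n arbitrary: i)
  case 0
  then show ?case using D Q by (auto simp: dyadic_boxes_def idx_def)
next
  case (Suc n)
  let ?s = "2 ^ CARD('n) :: nat"
  have "i < 2 ^ (n * CARD('n)) * ?s"
    using Suc.prems by (simp add: idx_def power_add mult.commute)
  \<comment> \<open>Quotient and remainder of \<open>i\<close> by \<open>2 ^ CARD('n)\<close> are
    the index of the parent box and the position among its children.\<close>
  then have i': "i div ?s \<in> idx CARD('n) n"
    by (simp add: idx_def less_mult_imp_div_less)
  then obtain q where q: "D n (i div ?s) = cbox q (q + (1 / 2 ^ n) *\<^sub>R w)"
    using Suc.IH by blast
  have nonneg: "0 \<le> ((1 / 2 ^ n) *\<^sub>R w) $ j" for j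
    by (simp add: less_imp_le[OF w])
  have "D (Suc n) (i div ?s * ?s + i mod ?s) \<in> subboxes 2 (D n (i div ?s))"
  proof -
    have "bij_betw (\<lambda>k. D (Suc n) (i div ?s * ?s + k)) {0..<?s} (subboxes 2 (D n (i div ?s)))"
      using D i' by (simp add: dyadic_boxes_def)
    from bij_betwE[OF this] show ?thesis by simp
  qed
  then have "D (Suc n) i \<in> subboxes 2 (cbox q (q + (1 / 2 ^ n) *\<^sub>R w))"
    by (simp only: q div_mult_mod_eq)
  then obtain r where "D (Suc n) i = cbox r (r + (1 / real 2) *\<^sub>R (1 / 2 ^ n) *\<^sub>R w)"
    using mem_subboxes[OF nonneg] by blast
  moreover have "(1 / real 2) *\<^sub>R (1 / 2 ^ n) *\<^sub>R w = (1 / 2 ^ Suc n) *\<^sub>R w"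
    by simp
  ultimately show ?case by metis
qed

lemma dyadic_boxes_cover:
  fixes Q :: "(real ^ 'n) set" and w :: "real ^ 'n"
  assumes D: "dyadic_boxes Q D" and Q: "Q = cbox p (p + w)" and w: "\<And>j. 0 < w $ j"
    and x: "x \<in> Q"
  shows "\<exists>i\<in>idx CARD('n) n. x \<in> D n i"
proof (induction n)
  case 0
  then show ?case using D x by (auto simp: dyadic_boxes_def idx_def)
next
  case (Suc n)
  let ?s = "2 ^ CARD('n) :: nat"
  obtain i where i: "i \<in> idx CARD('n) n" "x \<in> D n i" using Suc by auto
  obtain q where q: "D n i = cbox q (q + (1 / 2 ^ n) *\<^sub>R w)"
    using dyadic_boxes_shape[OF D Q w i(1)] by blast
  have "x \<in> \<Union> (subboxes 2 (D n i))"
    using i(2) by (simp add: q Union_subboxes w)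
  moreover have "subboxes 2 (D n i) = (\<lambda>k. D (Suc n) (i * ?s + k)) ` {0..<?s}"
    using D i(1) unfolding dyadic_boxes_def bij_betw_def by blast
  ultimately obtain k where k: "k < ?s" "x \<in> D (Suc n) (i * ?s + k)" by auto
  \<comment> \<open>The children of box \<open>i\<close> are numbered below
    \<open>(i + 1) * ?s\<close>, and \<open>i + 1\<close> is at most the number of boxes of level
    \<open>n\<close>.\<close>
  have "i * ?s + k < Suc i * ?s" using k by simp
  also have "\<dots> \<le> 2 ^ (n * CARD('n)) * ?s"
    using i(1) by (intro mult_right_mono) (auto simp: idx_def)
  finally have "i * ?s + k \<in> idx CARD('n) (Suc n)"
    by (simp add: idx_def power_add mult.commute)
  with k show ?case by blast
qed

section \<open>The diameters \<open>rho\<close>, the covering of preimages and the limit\<close>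

lemma rho_eq: "rho N Q n = enn2real (diam N Q) / 2 ^ n"
  by (induction n) (auto simp: field_simps)

theorem proposition9:
  fixes N :: "real ^ 'n \<Rightarrow> real"
    and f :: "real ^ 'n \<Rightarrow> real ^ 'n"
    and L :: real
    and Q :: "(real ^ 'n) set"
    and M :: nat
    and D :: "nat \<Rightarrow> nat \<Rightarrow> (real ^ 'n) set"
    and E :: "nat \<Rightarrow> nat \<Rightarrow> nat \<Rightarrow> (real ^ 'n) set"
  assumes "vector_norm N"
    and "homeomorphism UNIV UNIV f (inv f)"
    and "lipschitz_wrt N L (inv f)"
    and "is_box Q"
    and "M \<ge> 1"
    and "dyadic_boxes Q D"
    and "fine_boxes M D E"
  shows "((\<lambda>n. SUP i\<in>idx CARD('n) n.
            semidist N (\<Union>j\<in>phi N f L Q M D E n i. D n j) (inv f ` D n i)) \<longlonglongrightarrow> 0)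
       \<and> (\<forall>n. \<forall>i\<in>idx CARD('n) n.
            inv f ` D n i \<inter> Q \<subseteq> (\<Union>j\<in>phi N f L Q M D E n i. D n j))"
proof -
  note N = assms(1) and D = assms(6)
  obtain p b where pb: "\<forall>j. p $ j < b $ j" "Q = cbox p b"
    using assms(4) by (auto simp: is_box_def)
  define w where "w = b - p"
  have w: "\<And>j. 0 < w $ j" and Q: "Q = cbox p (p + w)"
    using pb by (auto simp: w_def)
  let ?I = "idx CARD('n)" and ?rho = "rho N Q" and ?vr = "varrho N Q M"
  let ?phi = "phi N f L Q M D E"
  have tri: "N (x + y) \<le> N x + N y" for x y using N by (simp add: vector_norm_def)
  have lip: "N (inv f x - inv f y) \<le> L * N (x - y)" and L: "0 \<le> L" for x y
    using assms(3) by (auto simp: lipschitz_wrt_def)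
  have diamD: "N (x - y) \<le> ?rho n" if i: "i \<in> ?I n" and xy: "x \<in> D n i" "y \<in> D n i" for n i x y
  proof -
    obtain q where "D n i = cbox q (q + (1 / 2 ^ n) *\<^sub>R w)"
      using dyadic_boxes_shape[OF D Q w i] by blast
    with xy norm_diff_le_scaled_diam[OF N, of "1 / 2 ^ n" x q w y p] show ?thesis
      by (simp add: Q rho_eq)
  qed
  have E_cover: "D n i = (\<Union>l\<in>{0..<M ^ CARD('n)}. E n i l)" if i: "i \<in> ?I n" for n i
  proof -
    obtain q where q: "D n i = cbox q (q + (1 / 2 ^ n) *\<^sub>R w)"
      using dyadic_boxes_shape[OF D Q w i] by blast
    have "(\<lambda>l. E n i l) ` {0..<M ^ CARD('n)} = subboxes M (D n i)"
      using assms(7) i unfolding fine_boxes_def bij_betw_def by blast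
    moreover have "\<Union> (subboxes M (D n i)) = D n i"
      using assms(5) by (simp add: q Union_subboxes w)
    ultimately show ?thesis by (metis (no_types))
  qed
  \<comment> \<open>The factor combines \<open>n\<close> halvings with one division into
    \<open>M\<close> parts, so the scaled diameter is exactly \<open>varrho\<close>.\<close>
  have E_shape: "\<exists>r. E n i l = cbox r (r + (1 / (2 ^ n * real M)) *\<^sub>R w)"
    if i: "i \<in> ?I n" and l: "l \<in> {0..<M ^ CARD('n)}" for n i l
  proof -
    obtain q where q: "D n i = cbox q (q + (1 / 2 ^ n) *\<^sub>R w)"
      using dyadic_boxes_shape[OF D Q w i] by blast
    have nonneg: "0 \<le> ((1 / 2 ^ n) *\<^sub>R w) $ j" for j
      by (simp add: less_imp_le[OF w])
    have "E n i l \<in> subboxes M (D n i)"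
      using assms(7) i l unfolding fine_boxes_def by (blast dest: bij_betwE)
    then have "E n i l \<in> subboxes M (cbox q (q + (1 / 2 ^ n) *\<^sub>R w))" by (simp add: q)
    then obtain r where "E n i l = cbox r (r + (1 / real M) *\<^sub>R (1 / 2 ^ n) *\<^sub>R w)"
      using mem_subboxes[OF nonneg] by blast
    moreover have "(1 / real M) *\<^sub>R (1 / 2 ^ n) *\<^sub>R w = (1 / (2 ^ n * real M)) *\<^sub>R w"
      by simp
    ultimately show ?thesis by metis
  qed
  have center: "box_center (E n i l) \<in> E n i l"
    if i: "i \<in> ?I n" and l: "l \<in> {0..<M ^ CARD('n)}" for n i l
  proof -
    obtain r where "E n i l = cbox r (r + (1 / (2 ^ n * real M)) *\<^sub>R w)"
      using E_shape[OF i l] by blast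
    then show ?thesis
      by (simp only:) (rule box_center_mem, simp add: less_imp_le[OF w])
  qed
  have diamE: "N (x - y) \<le> ?vr n"
    if i: "i \<in> ?I n" and l: "l \<in> {0..<M ^ CARD('n)}" and xy: "x \<in> E n i l" "y \<in> E n i l" for n i l x y
  proof -
    obtain r where "E n i l = cbox r (r + (1 / (2 ^ n * real M)) *\<^sub>R w)"
      using E_shape[OF i l] by blast
    with xy assms(5) norm_diff_le_scaled_diam[OF N, of "1 / (2 ^ n * real M)" x r w y p]
    show ?thesis by (simp add: Q rho_eq varrho_def)
  qed

  have cover: "inv f ` D n i \<inter> Q \<subseteq> (\<Union>j\<in>?phi n i. D n j)" if i: "i \<in> ?I n" for n i
  proof
    fix y assume "y \<in> inv f ` D n i \<inter> Q"
    then obtain x where x: "x \<in> D n i" "y = inv f x" and "y \<in> Q" by blast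
    then obtain j where j: "j \<in> ?I n" "y \<in> D n j"
      using dyadic_boxes_cover[OF D Q w] by blast
    \<comment> \<open>The fine box containing \<open>x\<close> supplies the center
      \<open>?z\<close>: both points lie in it, so their distance is at most its diameter.\<close>
    obtain l where l: "l \<in> {0..<M ^ CARD('n)}" "x \<in> E n i l"
      using x E_cover[OF i] by blast
    let ?z = "box_center (E n i l)"
    have "N (inv f x - inv f ?z) \<le> L * N (x - ?z)" by (rule lip)
    also have "\<dots> \<le> L * ?vr n"
      using diamE[OF i l center[OF i l(1)]] L by (intro mult_left_mono)
    finally have "inv f x - inv f ?z \<in> nball N (L * ?vr n)" by (simp add: nball_def)
    \<comment> \<open>This splits \<open>y\<close> as required by the Minkowski sum in
      \<open>phi\<close>; \<open>y\<close> itself witnesses that the sum meets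
      \<open>D n j\<close>.\<close>
    moreover have "y = inv f ?z + (inv f x - inv f ?z)" using x by simp
    ultimately have "y \<in> (\<Union>l\<in>{0..<M ^ CARD('n)}. {inv f (box_center (E n i l))})
        + nball N (L * ?vr n)"
      using l(1) unfolding set_plus_def by blast
    then have "j \<in> ?phi n i" using j by (auto simp: phi_def)
    then show "y \<in> (\<Union>j\<in>?phi n i. D n j)" using j by blast
  qed

  have semi: "semidist N (\<Union>j\<in>?phi n i. D n j) (inv f ` D n i) \<le> ennreal (?rho n + L * ?vr n)"
    if i: "i \<in> ?I n" for n i
    unfolding semidist_def
  proof (rule SUP_least)
    fix x assume "x \<in> (\<Union>j\<in>?phi n i. D n j)"
    then obtain j where jphi: "j \<in> ?phi n i" and x: "x \<in> D n j" by blast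
    then have j: "j \<in> ?I n" by (simp add: phi_def)
    \<comment> \<open>The point \<open>v\<close> lies both in \<open>D n j\<close> and in the
      neighbourhood of the center preimages. It links \<open>x\<close> to such a preimage:
      \<open>x - v\<close> costs one box diameter, \<open>u\<close> one ball radius.\<close>
    from jphi obtain v where v: "v \<in> D n j" and "v \<in> (\<Union>l\<in>{0..<M ^ CARD('n)}.
        {inv f (box_center (E n i l))}) + nball N (L * ?vr n)"
      by (auto simp: phi_def)
    then obtain l u where l: "l \<in> {0..<M ^ CARD('n)}" and u: "N u \<le> L * ?vr n"
      and vu: "v = inv f (box_center (E n i l)) + u"
      by (auto simp: set_plus_def nball_def)
    let ?z = "box_center (E n i l)"
    have "?z \<in> D n i" using E_cover[OF i] center[OF i l] l by blast
    have "N (x - inv f ?z) \<le> N (x - v) + N u"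
      using tri[of "x - v" u] by (simp add: vu)
    also have "\<dots> \<le> ?rho n + L * ?vr n"
      using diamD[OF j x v] u by linarith
    finally have "ennreal (N (x - inv f ?z)) \<le> ennreal (?rho n + L * ?vr n)"
      by (rule ennreal_leI)
    with \<open>?z \<in> D n i\<close> show "(INF y\<in>inv f ` D n i. ennreal (N (x - y))) \<le> ennreal (?rho n + L * ?vr n)"
      by (meson INF_lower2 imageI)
  qed

  have "?rho \<longlonglongrightarrow> 0"
  proof -
    have "(\<lambda>n. enn2real (diam N Q) * (1 / 2) ^ n) \<longlonglongrightarrow> enn2real (diam N Q) * 0"
      by (intro tendsto_mult_left LIMSEQ_power_zero) simp
    then show ?thesis by (simp add: rho_eq[abs_def] power_divide)
  qed
  then have "(\<lambda>n. ?rho n + L * ?vr n) \<longlonglongrightarrow> 0 + L * (0 / real M)"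
    unfolding varrho_def using assms(5) by (intro tendsto_intros) auto
  then have "(\<lambda>n. ennreal (?rho n + L * ?vr n)) \<longlonglongrightarrow> ennreal 0"
    by (intro tendsto_ennrealI) simp
  then have lim: "(\<lambda>n. ennreal (?rho n + L * ?vr n)) \<longlonglongrightarrow> 0"
    by (simp only: ennreal_0)
  have le: "(SUP i\<in>?I n. semidist N (\<Union>j\<in>?phi n i. D n j) (inv f ` D n i))
      \<le> ennreal (?rho n + L * ?vr n)" for n
    \<comment> \<open>The bound does not depend on \<open>i\<close>, so it passes to the
      supremum.\<close>
    by (rule SUP_least) (rule semi)
  have "(\<lambda>n. SUP i\<in>?I n. semidist N (\<Union>j\<in>?phi n i. D n j) (inv f ` D n i)) \<longlonglongrightarrow> 0"
    \<comment> \<open>The lower bound 0 is automatic, since the semidistance takes values in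
      \<open>ennreal\<close>.\<close>
    by (rule tendsto_sandwich[OF _ _ tendsto_const lim])
      (rule always_eventually, rule allI, rule zero_le le)+
  with cover show ?thesis by blast
qed

end
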